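(* Let $\Phi=(A;\{E_i\}_{i=0}^d;A^*;\{E_i^*\}_{i=0}^d)$ be a tridiagonal system of diameter $d\geq 1$ on $V$ over $\mathbb{K}$, and let $\Psi\in\mathrm{End}(V)$ be the linear transformation attached to $\Phi$ as defined in the context. Then $$\Psi E_i^*V\subseteq E_0^*V+E_1^*V+\cdots+E_{i-1}^*V\qquad(0\le i\le d).$$
   Context: $\mathbb{K}$ is a field, $V$ is a $\mathbb{K}$-vector space of finite positive dimension, $\mathrm{End}(V)$ is the algebra of linear maps $V\to V$. A tridiagonal pair (TD pair) on $V$ is an ordered pair $A,A^*\in\mathrm{End}(V)$ ($A^*$ is just a name, not an adjoint) such that: (i) $A$ and $A^*$ are each diagonalizable over $\mathbb{K}$; (ii) there is an ordering $\{V_i\}_{i=0}^d$ of the eigenspaces of $A$ with $A^*V_i\subseteq V_{i-1}+V_i+V_{i+1}$ for $0\le i\le d$, where $V_{-1}=V_{d+1}=0$; (iii) there is an ordering $\{V_i^*\}_{i=0}^{\delta}$ of the eigenspaces of $A^*$ with $AV_i^*\subseteq V_{i-1}^*+V_i^*+V_{i+1}^*$ for $0\le i\le\delta$, where $V_{-1}^*=V_{\delta+1}^*=0$; (iv) there is no subspace $W$ of $V$ with $AW\subseteq W$, $A^*W\subseteq W$, $W\ne0$, $W\ne V$. It is known that $d=\delta$; this is the diameter, and it is assumed that $d\ge1$. Orderings satisfying (ii) (resp. (iii)) are called standard. The primitive idempotent of a diagonalizable map associated with one of its eigenspaces is the projection of $V$ onto that eigenspace that kills the other eigenspaces. A tridiagonal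 system (TD system) on $V$ is a sequence $\Phi=(A;\{E_i\}_{i=0}^d;A^*;\{E_i^*\}_{i=0}^d)$ where $A,A^*$ is a TD pair on $V$, $\{E_i\}_{i=0}^d$ is an ordering of the primitive idempotents of $A$ such that $\{E_iV\}_{i=0}^d$ is standard, and $\{E_i^*\}_{i=0}^d$ is an ordering of the primitive idempotents of $A^*$ such that $\{E_i^*V\}_{i=0}^d$ is standard. Let $\theta_i$ be the eigenvalue of $A$ on $E_iV$. An empty sum of subspaces is $0$. For $0\le i\le d/2$ set $K_i=(E_0^*V+\cdots+E_i^*V)\cap(E_iV+E_{i+1}V+\cdots+E_{d-i}V)$. For $0\le i\le j\le d+1$ set $\tau_{ij}=(x-\theta_i)(x-\theta_{i+1})\cdots(x-\theta_{j-1})\in\mathbb{K}[x]$, with $\tau_{ii}=1$ and $\tau_{i,i-1}=0$. For $0\le i\le d+1$ set $\vartheta_i=\sum_{h=0}^{i-1}\frac{\theta_h-\theta_{d-h}}{\theta_0-\theta_d}$. It is known that $V=\bigoplus_{0\le i\le d/2}\bigoplus_{j=i}^{d-i}\tau_{ij}(A)K_i$. $\Psi$ is the unique element of $\mathrm{End}(V)$ such that $\Psi\tau_{ij}(A)v=(\vartheta_j-\vartheta_i)\tau_{i,j-1}(A)v$ for all $0\le i\le d/2$, $i\le j\le d-i$, $v\in K_i$. *)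

theory Defs
  imports
    Complex_Main
    "HOL-Computational_Algebra.Polynomial"
    "HOL-Library.Set_Algebras"
begin

text \<open>
  The vector space is the whole type \<open>'v\<close>, with scalar multiplication \<open>scale\<close> over a field \<open>'k\<close>.
  Sums of subspaces are the elementwise sums of \<open>HOL-Library.Set_Algebras\<close>, in which the empty
  sum is \<open>{0}\<close>.  A sequence indexed by \<open>0, \<dots>, d\<close> is a function on \<open>nat\<close> whose values beyond \<open>d\<close>
  are irrelevant.
\<close>

definition tau :: "(nat \<Rightarrow> 'k::field) \<Rightarrow> nat \<Rightarrow> nat \<Rightarrow> 'k poly" where
  "tau \<theta> i j = (\<Prod>h\<in>{i..<j}. [:- \<theta> h, 1:])"

definition vartheta :: "(nat \<Rightarrow> 'k::field) \<Rightarrow> nat \<Rightarrow> nat \<Rightarrow> 'k" where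
  "vartheta \<theta> d i = (\<Sum>h<i. (\<theta> h - \<theta> (d - h)) / (\<theta> 0 - \<theta> d))"

definition eigenspace :: "('k::field \<Rightarrow> 'v::ab_group_add \<Rightarrow> 'v) \<Rightarrow> ('v \<Rightarrow> 'v) \<Rightarrow> 'k \<Rightarrow> 'v set" where
  "eigenspace scale f t = {v. f v = scale t v}"

definition eigenspaces :: "('k::field \<Rightarrow> 'v::ab_group_add \<Rightarrow> 'v) \<Rightarrow> ('v \<Rightarrow> 'v) \<Rightarrow> 'v set set" where
  "eigenspaces scale f = {eigenspace scale f t | t. eigenspace scale f t \<noteq> {0}}"

definition diagonalizable :: "('k::field \<Rightarrow> 'v::ab_group_add \<Rightarrow> 'v) \<Rightarrow> ('v \<Rightarrow> 'v) \<Rightarrow> bool" where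
  "diagonalizable scale f \<longleftrightarrow> module.span scale (\<Union> (eigenspaces scale f)) = UNIV"

text \<open>\<open>V\<close> is an ordering of the eigenspaces of \<open>f\<close> on which \<open>g\<close> acts tridiagonally.\<close>

definition standard_ordering :: "('k::field \<Rightarrow> 'v::ab_group_add \<Rightarrow> 'v) \<Rightarrow> ('v \<Rightarrow> 'v) \<Rightarrow> ('v \<Rightarrow> 'v) \<Rightarrow> nat \<Rightarrow> (nat \<Rightarrow> 'v set) \<Rightarrow> bool" where
  "standard_ordering scale f g d V \<longleftrightarrow>
     bij_betw V {0..d} (eigenspaces scale f) \<and>
     (\<forall>i\<le>d. g ` V i \<subseteq> (if i = 0 then {0} else V (i - 1)) + V i + (if i = d then {0} else V (i + 1)))"

definition tridiagonal_pair :: "('k::field \<Rightarrow> 'v::ab_group_add \<Rightarrow> 'v) \<Rightarrow> ('v \<Rightarrow> 'v) \<Rightarrow> ('v \<Rightarrow> 'v) \<Rightarrow> bool" where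
  "tridiagonal_pair scale A As \<longleftrightarrow>
     Vector_Spaces.linear scale scale A \<and> Vector_Spaces.linear scale scale As \<and>
     diagonalizable scale A \<and> diagonalizable scale As \<and>
     (\<exists>d V. standard_ordering scale A As d V) \<and>
     (\<exists>\<delta> Vs. standard_ordering scale As A \<delta> Vs) \<and>
     \<not> (\<exists>W. module.subspace scale W \<and> A ` W \<subseteq> W \<and> As ` W \<subseteq> W \<and> W \<noteq> {0} \<and> W \<noteq> UNIV)"

definition primitive_idempotent :: "('k::field \<Rightarrow> 'v::ab_group_add \<Rightarrow> 'v) \<Rightarrow> ('v \<Rightarrow> 'v) \<Rightarrow> 'v set \<Rightarrow> ('v \<Rightarrow> 'v) \<Rightarrow> bool" where
  "primitive_idempotent scale f W P \<longleftrightarrow>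
     Vector_Spaces.linear scale scale P \<and> range P = W \<and> (\<forall>v\<in>W. P v = v) \<and>
     (\<forall>W'\<in>eigenspaces scale f. W' \<noteq> W \<longrightarrow> (\<forall>v\<in>W'. P v = 0))"

definition primitive_idempotents :: "('k::field \<Rightarrow> 'v::ab_group_add \<Rightarrow> 'v) \<Rightarrow> ('v \<Rightarrow> 'v) \<Rightarrow> ('v \<Rightarrow> 'v) set" where
  "primitive_idempotents scale f = {P. \<exists>W\<in>eigenspaces scale f. primitive_idempotent scale f W P}"

definition tridiagonal_system ::
  "('k::field \<Rightarrow> 'v::ab_group_add \<Rightarrow> 'v) \<Rightarrow> nat \<Rightarrow> ('v \<Rightarrow> 'v) \<Rightarrow> (nat \<Rightarrow> 'v \<Rightarrow> 'v) \<Rightarrow> ('v \<Rightarrow> 'v) \<Rightarrow> (nat \<Rightarrow> 'v \<Rightarrow> 'v) \<Rightarrow> bool" where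
  "tridiagonal_system scale d A E As Es \<longleftrightarrow>
     tridiagonal_pair scale A As \<and>
     bij_betw E {0..d} (primitive_idempotents scale A) \<and>
     standard_ordering scale A As d (\<lambda>i. range (E i)) \<and>
     bij_betw Es {0..d} (primitive_idempotents scale As) \<and>
     standard_ordering scale As A d (\<lambda>i. range (Es i))"

text \<open>The eigenvalue of \<open>A\<close> on \<open>E\<^sub>iV\<close>; it is unique because \<open>E\<^sub>iV \<noteq> 0\<close>.\<close>

definition eigenvalue_seq :: "('k::field \<Rightarrow> 'v::ab_group_add \<Rightarrow> 'v) \<Rightarrow> ('v \<Rightarrow> 'v) \<Rightarrow> (nat \<Rightarrow> 'v \<Rightarrow> 'v) \<Rightarrow> nat \<Rightarrow> 'k" where
  "eigenvalue_seq scale A E i = (THE t. \<forall>v\<in>range (E i). A v = scale t v)"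

definition K_space :: "nat \<Rightarrow> (nat \<Rightarrow> 'v::ab_group_add \<Rightarrow> 'v) \<Rightarrow> (nat \<Rightarrow> 'v \<Rightarrow> 'v) \<Rightarrow> nat \<Rightarrow> 'v set" where
  "K_space d E Es i = (\<Sum>h=0..i. range (Es h)) \<inter> (\<Sum>h=i..d - i. range (E h))"

definition poly_map :: "('k::field \<Rightarrow> 'v::ab_group_add \<Rightarrow> 'v) \<Rightarrow> 'k poly \<Rightarrow> ('v \<Rightarrow> 'v) \<Rightarrow> 'v \<Rightarrow> 'v" where
  "poly_map scale p f v = (\<Sum>n\<le>degree p. scale (coeff p n) ((f ^^ n) v))"

text \<open>
  The defining property of \<open>\<Psi>\<close>.  The case distinction implements the convention
  \<open>\<tau>\<^sub>i\<^sub>,\<^sub>i\<^sub>-\<^sub>1 = 0\<close>, since \<open>j - 1\<close> truncates on \<open>nat\<close>.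
\<close>

definition is_Psi ::
  "('k::field \<Rightarrow> 'v::ab_group_add \<Rightarrow> 'v) \<Rightarrow> nat \<Rightarrow> ('v \<Rightarrow> 'v) \<Rightarrow> (nat \<Rightarrow> 'v \<Rightarrow> 'v) \<Rightarrow> (nat \<Rightarrow> 'v \<Rightarrow> 'v) \<Rightarrow> ('v \<Rightarrow> 'v) \<Rightarrow> bool" where
  "is_Psi scale d A E Es \<Psi> \<longleftrightarrow>
     (let \<theta> = eigenvalue_seq scale A E in
      Vector_Spaces.linear scale scale \<Psi> \<and>
      (\<forall>i j. \<forall>v\<in>K_space d E Es i. 2 * i \<le> d \<longrightarrow> i \<le> j \<longrightarrow> j \<le> d - i \<longrightarrow>
         \<Psi> (poly_map scale (tau \<theta> i j) A v) =
           scale (vartheta \<theta> d j - vartheta \<theta> d i)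
             (if j = i then 0 else poly_map scale (tau \<theta> i (j - 1)) A v)))"

end

theory Submission imports Defs begin

text \<open>
  Write \<open>F\<^sub>i = E\<^sup>*\<^sub>0V + \<dots> + E\<^sup>*\<^sub>i\<^sub>-\<^sub>1V\<close> and \<open>G\<^sub>i = E\<^sub>iV + \<dots> + E\<^sub>dV\<close>.  The claim is weaker than
  \<open>\<Psi>F\<^sub>i\<^sub>+\<^sub>1 \<subseteq> F\<^sub>i\<close>, and this is what holds for a structural reason: \<open>\<Psi>\<close> carries the layer of
  vectors \<open>\<tau>\<^sub>j\<^sub>i(A)v\<close>, \<open>v \<in> K\<^sub>j\<close>, to the layer of vectors \<open>\<tau>\<^sub>j\<^sub>,\<^sub>i\<^sub>-\<^sub>1(A)v\<close>, which lies in \<open>F\<^sub>i\<close>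
  because \<open>v \<in> F\<^sub>j\<^sub>+\<^sub>1\<close> and each factor \<open>A - \<theta>\<^sub>h\<close> climbs at most one step in the flag \<open>F\<close>.
  So it has to be shown that the layers up to \<open>i\<close> span \<open>F\<^sub>i\<^sub>+\<^sub>1\<close>, which is the part of the
  decomposition \<open>V = \<Oplus> \<tau>\<^sub>i\<^sub>j(A)K\<^sub>i\<close> that matters; it is derived here from the axioms of a
  tridiagonal system.

  Irreducibility gives \<open>F\<^sub>i \<inter> G\<^sub>i = 0\<close> (\<open>lower_Int_upper_cross\<close>): the sum of these intersections
  is invariant under both maps.  The axioms are unchanged when \<open>A\<close> and \<open>A\<^sup>*\<close> are exchanged or
  when an ordering is reversed.  Comparing dimensions with the exchanged system turns the
  inequality \<open>dim F\<^sub>i + dim G\<^sub>i \<le> dim V\<close> into an equality, so \<open>V = F\<^sub>i \<oplus> G\<^sub>i\<close>, and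
  \<open>F\<^sub>i\<^sub>+\<^sub>1 = F\<^sub>i \<oplus> U\<^sub>i\<close> with \<open>U\<^sub>i = F\<^sub>i\<^sub>+\<^sub>1 \<inter> G\<^sub>i\<close> (\<open>lower_Suc\<close>).  The reversed system gives
  \<open>dim F\<^sub>i + dim F\<^sub>d\<^sub>+\<^sub>1\<^sub>-\<^sub>i = dim V\<close>, hence \<open>dim U\<^sub>i = dim U\<^sub>d\<^sub>-\<^sub>i\<close>, and also the injectivity of
  \<open>\<tau>\<^sub>i\<^sub>,\<^sub>d\<^sub>-\<^sub>i(A)\<close> on \<open>U\<^sub>i\<close> for \<open>2i \<le> d\<close>; therefore this map sends \<open>U\<^sub>i\<close> onto \<open>U\<^sub>d\<^sub>-\<^sub>i\<close>
  (\<open>T_U_onto\<close>).  Surjectivity lets one split off from each vector of \<open>U\<^sub>i\<close> a component in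
  \<open>K\<^sub>i\<close>, leaving an image of \<open>U\<^sub>i\<^sub>-\<^sub>1\<close>; by induction \<open>U\<^sub>i\<close> is spanned by the \<open>\<tau>\<^sub>j\<^sub>i(A)K\<^sub>j\<close>
  (\<open>U_subset_S\<close>).
\<close>

section \<open>Eigenprojections\<close>

text \<open>
  A diagonalizable map is handled through its eigenprojections: since \<open>E\<^sub>h p(A) = p(\<theta>\<^sub>h) E\<^sub>h\<close>
  and a vector is determined by its components \<open>E\<^sub>h v\<close>, identities between polynomials in \<open>A\<close>
  reduce to identities between scalars.  The conditions are invariant under reindexing the
  projections, which is what makes reversal available later.
\<close>

locale eigen_resolution = vector_space scale
  for scale :: "'k::field \<Rightarrow> 'v::ab_group_add \<Rightarrow> 'v" +
  fixes d :: nat and A :: "'v \<Rightarrow> 'v" and E :: "nat \<Rightarrow> 'v \<Rightarrow> 'v" and \<theta> :: "nat \<Rightarrow> 'k"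
  assumes linear_A: "Vector_Spaces.linear scale scale A"
    and linear_E: "h \<le> d \<Longrightarrow> Vector_Spaces.linear scale scale (E h)"
    and E_E: "h \<le> d \<Longrightarrow> k \<le> d \<Longrightarrow> E h (E k v) = (if h = k then E k v else 0)"
    and sum_E: "(\<Sum>h\<le>d. E h v) = v"
    and A_E: "h \<le> d \<Longrightarrow> A (E h v) = scale (\<theta> h) (E h v)"
    and inj_\<theta>: "inj_on \<theta> {..d}"
    and E_nonzero: "h \<le> d \<Longrightarrow> \<exists>v. E h v \<noteq> 0"

text \<open>
  Partial sums of eigenspaces, given by the vanishing of the complementary components:
  \<open>lower d E i\<close> is \<open>E\<^sub>0V + \<dots> + E\<^sub>i\<^sub>-\<^sub>1V\<close> and \<open>upper d E i\<close> is \<open>E\<^sub>iV + \<dots> + E\<^sub>dV\<close>.  With this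
  half-open indexing \<open>lower d E i\<close> and \<open>upper d E i\<close> are complementary, and the extreme
  cases \<open>i = 0\<close> and \<open>i = d + 1\<close> need no convention.
\<close>

definition lower :: "nat \<Rightarrow> (nat \<Rightarrow> 'v \<Rightarrow> 'v::zero) \<Rightarrow> nat \<Rightarrow> 'v set" where
  "lower d E i = {v. \<forall>h\<le>d. i \<le> h \<longrightarrow> E h v = 0}"

definition upper :: "nat \<Rightarrow> (nat \<Rightarrow> 'v \<Rightarrow> 'v::zero) \<Rightarrow> nat \<Rightarrow> 'v set" where
  "upper d E i = {v. \<forall>h\<le>d. h < i \<longrightarrow> E h v = 0}"

lemma lowerD: "v \<in> lower d E i \<Longrightarrow> i \<le> h \<Longrightarrow> h \<le> d \<Longrightarrow> E h v = 0"
  by (simp add: lower_def)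

lemma upperD: "v \<in> upper d E i \<Longrightarrow> h < i \<Longrightarrow> h \<le> d \<Longrightarrow> E h v = 0"
  by (simp add: upper_def)

lemma lower_mono: "i \<le> j \<Longrightarrow> lower d E i \<subseteq> lower d E j"
  by (auto simp: lower_def)

lemma upper_antimono: "i \<le> j \<Longrightarrow> upper d E j \<subseteq> upper d E i"
  by (auto simp: upper_def)

lemma lower_reverse:
  assumes "i \<le> Suc d"
  shows "lower d (\<lambda>h. E (d - h)) i = upper d E (Suc d - i)"
proof -
  have "E h v = 0" if "\<forall>h\<le>d. i \<le> h \<longrightarrow> E (d - h) v = 0" "h \<le> d" "h < Suc d - i" for h v
    using that(1)[rule_format, of "d - h"] that(2,3) by simp
  then show ?thesis
    using assms by (auto simp: lower_def upper_def)
qed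

lemma upper_reverse:
  assumes "i \<le> Suc d"
  shows "upper d (\<lambda>h. E (d - h)) i = lower d E (Suc d - i)"
proof -
  have "E h v = 0" if "\<forall>h\<le>d. h < i \<longrightarrow> E (d - h) v = 0" "h \<le> d" "Suc d - i \<le> h" for h v
    using that(1)[rule_format, of "d - h"] that(2,3) assms by simp
  then show ?thesis
    using assms by (auto simp: lower_def upper_def)
qed

lemma poly_tau: "poly (tau \<theta> i j) x = (\<Prod>h\<in>{i..<j}. x - \<theta> h)"
  by (simp add: tau_def poly_prod)

context eigen_resolution
begin

interpretation lm: vector_space_pair scale scale ..

lemmas A_sum = lm.linear_sum[OF linear_A]
  and A_zero = lm.linear_0[OF linear_A]

lemmas E_add = lm.linear_add[OF linear_E]
  and E_scale = lm.linear_scale[OF linear_E]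
  and E_diff = lm.linear_diff[OF linear_E]
  and E_sum = lm.linear_sum[OF linear_E]
  and E_zero = lm.linear_0[OF linear_E]

lemma eqI: "(\<And>h. h \<le> d \<Longrightarrow> E h v = E h w) \<Longrightarrow> v = w"
  using sum_E[of v] sum_E[of w] by (metis (no_types, lifting) atMost_iff sum.cong)

lemma subspace_lower: "subspace (lower d E i)"
  by (auto simp: subspace_def lower_def E_add E_scale E_zero)

lemma subspace_upper: "subspace (upper d E i)"
  by (auto simp: subspace_def upper_def E_add E_scale E_zero)

lemma lower_0: "lower d E 0 = {0}"
  using eqI[where w = 0] by (auto simp: lower_def E_zero)

lemma upper_Suc_d: "upper d E (Suc d) = {0}"
  using eqI[where w = 0] by (auto simp: upper_def E_zero)

lemma lower_Int_upper: "lower d E i \<inter> upper d E i = {0}"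
proof -
  have "v = 0" if "v \<in> lower d E i" "v \<in> upper d E i" for v
    by (rule eqI) (metis E_zero linorder_not_le lowerD[OF that(1)] upperD[OF that(2)])
  then show ?thesis
    by (auto simp: lower_def upper_def E_zero)
qed

lemma sum_E_part:
  assumes "h \<le> d" "S \<subseteq> {..d}"
  shows "E h (\<Sum>k\<in>S. E k v) = (if h \<in> S then E h v else 0)"
proof -
  have "finite S"
    using assms(2) finite_subset by blast
  have "E h (\<Sum>k\<in>S. E k v) = (\<Sum>k\<in>S. if h = k then E k v else 0)"
    using assms by (subst E_sum) (auto intro!: sum.cong simp: E_E subset_iff)
  then show ?thesis
    using \<open>finite S\<close> by (simp add: sum.delta')
qed

lemma lower_plus_upper: "\<exists>a\<in>lower d E i. \<exists>b\<in>upper d E i. v = a + b"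
proof -
  let ?a = "\<Sum>k\<in>{..d} \<inter> {..<i}. E k v"
  have "?a \<in> lower d E i"
    by (auto simp: lower_def sum_E_part)
  moreover have "v - ?a \<in> upper d E i"
    by (auto simp: upper_def sum_E_part E_diff)
  ultimately show ?thesis
    by (metis add.commute diff_add_cancel)
qed

lemma E_A:
  assumes "h \<le> d"
  shows "E h (A v) = scale (\<theta> h) (E h v)"
proof -
  have "A v = A (\<Sum>k\<le>d. E k v)"
    by (simp add: sum_E)
  also have "\<dots> = (\<Sum>k\<le>d. scale (\<theta> k) (E k v))"
    by (simp add: A_sum A_E)
  finally have "E h (A v) = (\<Sum>k\<le>d. scale (\<theta> k) (if h = k then E k v else 0))"
    using assms by (simp add: E_sum E_scale E_E)
  also have "\<dots> = (\<Sum>k\<le>d. if h = k then scale (\<theta> k) (E k v) else 0)"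
    by (intro sum.cong) auto
  finally have "E h (A v) = \<dots>" .
  then show ?thesis
    using assms by simp
qed

lemma E_poly_map:
  assumes "h \<le> d"
  shows "E h (poly_map scale p A v) = scale (poly p (\<theta> h)) (E h v)"
proof -
  have "E h ((A ^^ n) v) = scale (\<theta> h ^ n) (E h v)" for n
    by (induction n) (auto simp: E_A assms)
  then show ?thesis
    using assms by (simp add: poly_map_def E_sum E_scale poly_altdef scale_sum_left)
qed

abbreviation T :: "nat \<Rightarrow> nat \<Rightarrow> 'v \<Rightarrow> 'v" where
  "T i j \<equiv> poly_map scale (tau \<theta> i j) A"

lemma linear_poly_map: "Vector_Spaces.linear scale scale (poly_map scale p A)"
proof (unfold Vector_Spaces.linear_iff, intro conjI allI vector_space_axioms)
  fix v w c
  show "poly_map scale p A (v + w) = poly_map scale p A v + poly_map scale p A w"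
    by (rule eqI) (simp add: E_poly_map E_add scale_right_distrib)
  show "poly_map scale p A (scale c v) = scale c (poly_map scale p A v)"
    by (rule eqI) (simp add: E_poly_map E_scale mult.commute)
qed

lemma T_refl: "T i i v = v"
  by (rule eqI) (simp add: E_poly_map poly_tau)

lemma T_Suc: "i \<le> j \<Longrightarrow> T i (Suc j) v = A (T i j v) - scale (\<theta> j) (T i j v)"
  by (rule eqI) (simp add: E_poly_map E_A E_diff E_scale poly_tau scale_left_diff_distrib left_diff_distrib
      mult.commute)

lemma T_T: "i \<le> j \<Longrightarrow> j \<le> k \<Longrightarrow> T j k (T i j v) = T i k v"
  by (rule eqI)
    (simp add: E_poly_map poly_tau prod.atLeastLessThan_concat[symmetric, of i j k] mult.commute)

text \<open>The factors \<open>A - \<theta>\<^sub>i, \<dots>, A - \<theta>\<^sub>j\<^sub>-\<^sub>1\<close> kill the components \<open>i, \<dots>, j - 1\<close>.\<close>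

lemma T_upper:
  assumes "v \<in> upper d E i"
  shows "T i j v \<in> upper d E j"
proof -
  have "E h (T i j v) = 0" if "h \<le> d" "h < j" for h
  proof (cases "h < i")
    case True
    then show ?thesis
      using assms that by (simp add: E_poly_map upperD)
  next
    case False
    then have "(\<Prod>k\<in>{i..<j}. \<theta> h - \<theta> k) = 0"
      using that by (intro prod_zero) auto
    then show ?thesis
      using that by (simp add: E_poly_map poly_tau)
  qed
  then show ?thesis
    by (simp add: upper_def)
qed

text \<open>
  On the components from \<open>j\<close> on, \<open>\<tau>\<^sub>i\<^sub>j(A)\<close> acts by nonzero scalars, the eigenvalues being distinct.
\<close>

lemma T_eq_0:
  assumes "T i j v = 0"
  shows "v \<in> lower d E j"
proof -
  have "E h v = 0" if "h \<le> d" "j \<le> h" for h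
  proof -
    have "\<theta> h - \<theta> k \<noteq> 0" if "k \<in> {i..<j}" for k
      using inj_onD[OF inj_\<theta>, of h k] \<open>h \<le> d\<close> \<open>j \<le> h\<close> that by auto
    then have "(\<Prod>k\<in>{i..<j}. \<theta> h - \<theta> k) \<noteq> 0"
      by simp
    then show ?thesis
      using assms E_poly_map[OF \<open>h \<le> d\<close>, of "tau \<theta> i j" v] \<open>h \<le> d\<close> E_zero[OF \<open>h \<le> d\<close>]
      by (simp add: poly_tau scale_eq_0_iff)
  qed
  then show ?thesis
    by (simp add: lower_def)
qed

lemma range_E_nonzero: "h \<le> d \<Longrightarrow> E h v \<noteq> 0 \<Longrightarrow> E h v \<notin> upper d E (Suc h)"
  using upperD[of "E h v" d E "Suc h" h] by (auto simp: E_E)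

lemma lower_subset_sum_range:
  assumes "i \<le> Suc d"
  shows "lower d E i \<inter> upper d E j \<subseteq> (\<Sum>h\<in>{j..<i}. range (E h))"
proof
  fix v
  assume "v \<in> lower d E i \<inter> upper d E j"
  then have "(\<Sum>h\<le>d. E h v) = (\<Sum>h\<in>{j..<i}. E h v)"
    using assms by (intro sum.mono_neutral_right) (auto simp: lower_def upper_def)
  then have "v = (\<Sum>h\<in>{j..<i}. E h v)"
    by (simp add: sum_E)
  then show "v \<in> (\<Sum>h\<in>{j..<i}. range (E h))"
    by (auto simp: set_sum_alt)
qed

end

section \<open>Transversality of the flags\<close>

text \<open>
  The roles of \<open>(A, E, \<theta>)\<close> and \<open>(A\<^sup>*, E\<^sup>*, \<theta>\<^sup>*)\<close> are symmetric, and no condition depends on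
  the direction in which the projections are numbered.
\<close>

locale td_system = finite_dimensional_vector_space scale Basis
    + P: eigen_resolution scale d A E \<theta> + Ps: eigen_resolution scale d As Es \<theta>s
  for scale :: "'k::field \<Rightarrow> 'v::ab_group_add \<Rightarrow> 'v" and Basis d A E \<theta> As Es \<theta>s +
  assumes tridiag_As: "h \<le> d \<Longrightarrow> k \<le> d \<Longrightarrow> Suc h < k \<or> Suc k < h \<Longrightarrow> E h (As (E k v)) = 0"
    and tridiag_A: "h \<le> d \<Longrightarrow> k \<le> d \<Longrightarrow> Suc h < k \<or> Suc k < h \<Longrightarrow> Es h (A (Es k v)) = 0"
    and irreducible: "subspace W \<Longrightarrow> A ` W \<subseteq> W \<Longrightarrow> As ` W \<subseteq> W \<Longrightarrow> W = {0} \<or> W = UNIV"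
begin

interpretation lm: finite_dimensional_vector_space_pair scale Basis scale Basis ..

lemma dual: "td_system scale Basis d As Es \<theta>s A E \<theta>"
proof (intro td_system.intro td_system_axioms.intro)
  fix W
  assume "subspace W" "As ` W \<subseteq> W" "A ` W \<subseteq> W"
  then show "W = {0} \<or> W = UNIV"
    by (intro irreducible)
qed (fact finite_dimensional_vector_space_axioms P.eigen_resolution_axioms
    Ps.eigen_resolution_axioms tridiag_As tridiag_A)+

lemma reverse: "td_system scale Basis d A (\<lambda>h. E (d - h)) (\<lambda>h. \<theta> (d - h)) As Es \<theta>s"
proof -
  have "(\<Sum>h\<le>d. E (d - h) v) = v" for v
  proof -
    have "(\<Sum>h\<le>d. E (d - h) v) = (\<Sum>h\<le>d. E h v)"
      by (rule sum.reindex_bij_witness[of _ "\<lambda>h. d - h" "\<lambda>h. d - h"]) auto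
    then show ?thesis
      by (simp add: P.sum_E)
  qed
  moreover have "inj_on (\<lambda>h. \<theta> (d - h)) {..d}"
  proof (rule inj_onI)
    fix h k
    assume "h \<in> {..d}" "k \<in> {..d}" "\<theta> (d - h) = \<theta> (d - k)"
    then show "h = k"
      using inj_onD[OF P.inj_\<theta>, of "d - h" "d - k"] by auto
  qed
  moreover have "E (d - h) (E (d - k) v) = (if h = k then E (d - k) v else 0)"
    if "h \<le> d" "k \<le> d" for h k v
    using that by (auto simp: P.E_E)
  ultimately have "eigen_resolution scale d A (\<lambda>h. E (d - h)) (\<lambda>h. \<theta> (d - h))"
    using P.linear_E P.A_E P.E_nonzero P.linear_A
    by (intro eigen_resolution.intro eigen_resolution_axioms.intro vector_space_axioms) simp_all
  moreover have "E (d - h) (As (E (d - k) v)) = 0"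
    if "h \<le> d" "k \<le> d" "Suc h < k \<or> Suc k < h" for h k v
    using that by (intro tridiag_As) auto
  ultimately show ?thesis
    by (intro td_system.intro td_system_axioms.intro finite_dimensional_vector_space_axioms
        Ps.eigen_resolution_axioms tridiag_A irreducible)
qed

lemma As_upper:
  assumes "v \<in> upper d E (Suc j)"
  shows "As v \<in> upper d E j"
proof -
  have "E h (As v) = 0" if "h \<le> d" "h < j" for h
  proof -
    have "E h (As v) = E h (As (\<Sum>k\<le>d. E k v))"
      by (simp add: P.sum_E)
    also have "\<dots> = (\<Sum>k\<le>d. E h (As (E k v)))"
      using that by (simp add: Ps.A_sum P.E_sum)
    also have "\<dots> = 0"
    proof (rule sum.neutral, intro ballI)
      fix k
      assume "k \<in> {..d}"
      then show "E h (As (E k v)) = 0"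
        using that upperD[OF assms, of k] tridiag_As[of h k v]
        by (cases "k \<le> j") (auto simp: Ps.A_zero P.E_zero)
    qed
    finally show ?thesis .
  qed
  then show ?thesis
    by (simp add: upper_def)
qed

lemma A_lower:
  assumes "v \<in> lower d Es i"
  shows "A v \<in> lower d Es (Suc i)"
proof -
  have "Es h (A v) = 0" if "h \<le> d" "Suc i \<le> h" for h
  proof -
    have "Es h (A v) = Es h (A (\<Sum>k\<le>d. Es k v))"
      by (simp add: Ps.sum_E)
    also have "\<dots> = (\<Sum>k\<le>d. Es h (A (Es k v)))"
      using that by (simp add: P.A_sum Ps.E_sum)
    also have "\<dots> = 0"
    proof (rule sum.neutral, intro ballI)
      fix k
      assume "k \<in> {..d}"
      then show "Es h (A (Es k v)) = 0"
        using that lowerD[OF assms, of k] tridiag_A[of h k v]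
        by (cases "k < i") (auto simp: P.A_zero Ps.E_zero)
    qed
    finally show ?thesis .
  qed
  then show ?thesis
    by (simp add: lower_def)
qed

text \<open>
  On \<open>X\<^sub>i = F\<^sub>i \<inter> G\<^sub>i\<close> the map \<open>A - \<theta>\<^sub>i\<close> climbs to \<open>X\<^sub>i\<^sub>+\<^sub>1\<close>: it kills the lowest component
  for \<open>A\<close> and adds at most one for \<open>A\<^sup>*\<close>.  Likewise \<open>A\<^sup>* - \<theta>\<^sup>*\<^sub>i\<^sub>-\<^sub>1\<close> descends to \<open>X\<^sub>i\<^sub>-\<^sub>1\<close>.
  Hence the span of all \<open>X\<^sub>i\<close> is invariant under both maps.  It lies in \<open>G\<^sub>1 \<noteq> V\<close>, because
  \<open>X\<^sub>0 = 0\<close>, so it is zero by irreducibility.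
\<close>

lemma lower_Int_upper_cross:
  assumes "i \<le> Suc d"
  shows "lower d Es i \<inter> upper d E i = {0}"
proof -
  let ?X = "\<lambda>i. lower d Es i \<inter> upper d E i"
  define W where "W = span (\<Union>i\<le>Suc d. ?X i)"
  have W: "subspace W"
    by (simp add: W_def)
  have X_W: "?X i \<subseteq> W" if "i \<le> Suc d" for i
    using that span_superset unfolding W_def by fastforce
  have invariant: "f ` W \<subseteq> W"
    if "Vector_Spaces.linear scale scale f" "\<And>i v. i \<le> Suc d \<Longrightarrow> v \<in> ?X i \<Longrightarrow> f v \<in> W" for f
  proof -
    have "f ` W = span (f ` (\<Union>i\<le>Suc d. ?X i))"
      unfolding W_def using that(1) by (rule lm.linear_span_image[symmetric])
    also have "\<dots> \<subseteq> W"
      using that(2) W by (intro span_minimal) auto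
    finally show ?thesis .
  qed
  have "A ` W \<subseteq> W"
  proof (rule invariant[OF P.linear_A])
    fix i v
    assume i: "i \<le> Suc d" and v: "v \<in> ?X i"
    show "A v \<in> W"
    proof (cases "i = Suc d")
      case True
      then have "v = 0"
        using v P.upper_Suc_d by blast
      then show ?thesis
        using W by (simp add: P.A_zero subspace_0)
    next
      case False
      have "A v - scale (\<theta> i) v \<in> lower d Es (Suc i)"
        using v A_lower lower_mono[of i "Suc i" d Es]
        by (intro subspace_diff subspace_scale Ps.subspace_lower) auto
      moreover have "A v - scale (\<theta> i) v \<in> upper d E (Suc i)"
        using P.T_upper[of v i "Suc i"] v by (simp add: P.T_Suc P.T_refl)
      ultimately have "A v - scale (\<theta> i) v \<in> W"
        using X_W[of "Suc i"] False i by auto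
      moreover have "scale (\<theta> i) v \<in> W"
        using X_W[OF i] v W by (auto intro: subspace_scale)
      ultimately show ?thesis
        using subspace_add[OF W] by (metis diff_add_cancel)
    qed
  qed
  moreover have "As ` W \<subseteq> W"
  proof (rule invariant[OF Ps.linear_A])
    fix i v
    assume i: "i \<le> Suc d" and v: "v \<in> ?X i"
    show "As v \<in> W"
    proof (cases i)
      case 0
      then have "v = 0"
        using v Ps.lower_0 by blast
      then show ?thesis
        using W by (simp add: Ps.A_zero subspace_0)
    next
      case (Suc j)
      have "Es h (As v - scale (\<theta>s j) v) = 0" if "h \<le> d" "j \<le> h" for h
        using that v Suc lowerD[of v d Es i h]
        by (cases "h = j") (auto simp: Ps.E_diff Ps.E_scale Ps.E_A)
      then have "As v - scale (\<theta>s j) v \<in> lower d Es j"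
        by (simp add: lower_def)
      moreover have "As v - scale (\<theta>s j) v \<in> upper d E j"
        using v Suc As_upper upper_antimono[of j "Suc j" d E]
        by (intro subspace_diff subspace_scale P.subspace_upper) auto
      ultimately have "As v - scale (\<theta>s j) v \<in> W"
        using X_W[of j] Suc i by auto
      moreover have "scale (\<theta>s j) v \<in> W"
        using X_W[OF i] v W by (auto intro: subspace_scale)
      ultimately show ?thesis
        using subspace_add[OF W] by (metis diff_add_cancel)
    qed
  qed
  moreover have "W \<noteq> UNIV"
  proof -
    have "?X i \<subseteq> upper d E 1" for i
    proof (cases i)
      case 0
      then show ?thesis
        using Ps.lower_0 subspace_0[OF P.subspace_upper] by auto
    next
      case (Suc j)
      then show ?thesis
        using upper_antimono[of 1 i d E] by auto
    qed
    then have "W \<subseteq> upper d E 1"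
      unfolding W_def by (intro span_minimal P.subspace_upper) auto
    moreover obtain v where "E 0 v \<noteq> 0"
      using P.E_nonzero by auto
    ultimately show ?thesis
      using P.range_E_nonzero[of 0 v] by auto
  qed
  ultimately have "W = {0}"
    using irreducible[OF W] by blast
  then show ?thesis
    using X_W[OF assms] subspace_0[OF Ps.subspace_lower] subspace_0[OF P.subspace_upper] by auto
qed

lemma dim_sum_direct:
  assumes "subspace S" "subspace R" "S \<inter> R = {0}"
  shows "dim {x + y |x y. x \<in> S \<and> y \<in> R} = dim S + dim R"
  using dim_sums_Int[OF assms(1,2)] assms(3) by simp

lemma dim_lower_upper: "dim (lower d E i) + dim (upper d E i) = dimension"
proof -
  have "v \<in> {x + y |x y. x \<in> lower d E i \<and> y \<in> upper d E i}" for v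
    using P.lower_plus_upper[of i v] by blast
  then have "{x + y |x y. x \<in> lower d E i \<and> y \<in> upper d E i} = UNIV"
    by blast
  then show ?thesis
    using dim_sum_direct[OF P.subspace_lower P.subspace_upper P.lower_Int_upper, of i]
    by (simp add: dimension_def)
qed

lemma dim_lower_le:
  assumes "i \<le> Suc d"
  shows "dim (lower d Es i) \<le> dim (lower d E i)"
  using dim_sum_direct[OF Ps.subspace_lower P.subspace_upper lower_Int_upper_cross[OF assms]]
    dim_lower_upper[of i] dim_subset_UNIV[of "{x + y |x y. x \<in> lower d Es i \<and> y \<in> upper d E i}"]
  by simp

text \<open>Exchanging \<open>A\<close> and \<open>A\<^sup>*\<close> gives the opposite inequality.\<close>

lemma dim_lower_eq: "i \<le> Suc d \<Longrightarrow> dim (lower d Es i) = dim (lower d E i)"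
  by (intro le_antisym dim_lower_le td_system.dim_lower_le[OF dual])

lemma lower_plus_upper_cross:
  assumes "i \<le> Suc d"
  shows "\<exists>a\<in>lower d Es i. \<exists>b\<in>upper d E i. v = a + b"
proof -
  let ?S = "{x + y |x y. x \<in> lower d Es i \<and> y \<in> upper d E i}"
  have "dim ?S = dimension"
    using dim_sum_direct[OF Ps.subspace_lower P.subspace_upper lower_Int_upper_cross[OF assms]]
      dim_lower_upper[of i] dim_lower_eq[OF assms] by simp
  then have "span ?S = UNIV"
    by (simp add: dim_eq_full)
  moreover have "subspace ?S"
    by (intro subspace_sums Ps.subspace_lower P.subspace_upper)
  then have "span ?S = ?S"
    by (simp only: span_eq_iff)
  ultimately have "v \<in> ?S"
    by simp
  then show ?thesis
    by blast
qed

text \<open>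
  Reversing the ordering of the eigenspaces of \<open>A\<close> turns \<open>G\<^sub>i\<close> into
  \<open>E\<^sub>0V + \<dots> + E\<^sub>d\<^sub>-\<^sub>iV\<close>.
\<close>

lemma lower_Int_lower_cross:
  assumes "i \<le> Suc d"
  shows "lower d Es i \<inter> lower d E (Suc d - i) = {0}"
  using td_system.lower_Int_upper_cross[OF reverse assms] by (simp only: upper_reverse[OF assms])

text \<open>
  In the reversed system \<open>dim F\<^sub>i\<close> is the dimension of a final sum of eigenspaces of \<open>A\<close>, in
  the original one that of an initial sum.
\<close>

lemma dim_lower_complement:
  assumes "i \<le> Suc d"
  shows "dim (lower d Es i) + dim (lower d Es (Suc d - i)) = dimension"
proof -
  have "dim (lower d Es i) = dim (upper d E (Suc d - i))"
    using td_system.dim_lower_eq[OF reverse assms] by (simp only: lower_reverse[OF assms])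
  moreover have "dim (lower d Es (Suc d - i)) = dim (lower d E (Suc d - i))"
    by (rule dim_lower_eq) simp
  ultimately show ?thesis
    using dim_lower_upper[of "Suc d - i"] by simp
qed

section \<open>The split decomposition\<close>

definition U :: "nat \<Rightarrow> 'v set" where
  "U i = lower d Es (Suc i) \<inter> upper d E i"

lemma subspace_U: "subspace (U i)"
  unfolding U_def by (intro subspace_inter Ps.subspace_lower P.subspace_upper)

text \<open>This is the modular law for \<open>F\<^sub>i \<subseteq> F\<^sub>i\<^sub>+\<^sub>1\<close> and \<open>V = F\<^sub>i + G\<^sub>i\<close>.\<close>

lemma lower_Suc:
  assumes "i \<le> d"
  shows "lower d Es (Suc i) = {x + y |x y. x \<in> lower d Es i \<and> y \<in> U i}"
proof (intro equalityI subsetI)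
  fix v
  assume v: "v \<in> lower d Es (Suc i)"
  obtain a b where ab: "a \<in> lower d Es i" "b \<in> upper d E i" "v = a + b"
    using lower_plus_upper_cross[OF le_SucI[OF assms], of v] by blast
  have "v - a \<in> lower d Es (Suc i)"
    using v ab(1) lower_mono[of i "Suc i" d Es] by (intro subspace_diff Ps.subspace_lower) auto
  then have "b \<in> U i"
    using ab by (simp add: U_def)
  then show "v \<in> {x + y |x y. x \<in> lower d Es i \<and> y \<in> U i}"
    using ab by blast
next
  fix v
  assume "v \<in> {x + y |x y. x \<in> lower d Es i \<and> y \<in> U i}"
  then obtain x y where "x \<in> lower d Es i" "y \<in> U i" "v = x + y"
    by blast
  moreover from this have "x \<in> lower d Es (Suc i)" "y \<in> lower d Es (Suc i)"
    using lower_mono[of i "Suc i" d Es] by (auto simp: U_def)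
  ultimately show "v \<in> lower d Es (Suc i)"
    by (simp add: subspace_add Ps.subspace_lower)
qed

lemma dim_U:
  assumes "i \<le> d"
  shows "dim (lower d Es (Suc i)) = dim (lower d Es i) + dim (U i)"
proof -
  have "lower d Es i \<inter> U i = {0}"
    using lower_Int_upper_cross[of i] assms subspace_0[OF subspace_U[of i]]
      subspace_0[OF Ps.subspace_lower[of i]] by (auto simp: U_def)
  then show ?thesis
    unfolding lower_Suc[OF assms] by (intro dim_sum_direct Ps.subspace_lower subspace_U)
qed

lemma dim_U_reflect:
  assumes "i \<le> d"
  shows "dim (U i) = dim (U (d - i))"
  using dim_U[OF assms] dim_U[of "d - i"] dim_lower_complement[of i] dim_lower_complement[of "Suc i"]
    assms by (simp add: Suc_diff_le)

lemma T_lower: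
  assumes "v \<in> lower d Es m" "i \<le> j"
  shows "P.T i j v \<in> lower d Es (m + (j - i))"
  using assms(2)
proof (induction j rule: dec_induct)
  case base
  then show ?case
    using assms(1) by (simp add: P.T_refl)
next
  case (step j)
  have "A (P.T i j v) \<in> lower d Es (m + (Suc j - i))"
    using A_lower[OF step.IH] step.hyps by (simp add: Suc_diff_le)
  moreover have "P.T i j v \<in> lower d Es (m + (Suc j - i))"
    by (rule subsetD[OF lower_mono step.IH]) arith
  ultimately show ?case
    using step.hyps by (auto simp: P.T_Suc intro!: subspace_diff subspace_scale Ps.subspace_lower)
qed

lemma T_U: "v \<in> U i \<Longrightarrow> i \<le> j \<Longrightarrow> P.T i j v \<in> U j"
  using T_lower[of v "Suc i" i j] P.T_upper[of v i j] by (simp add: U_def)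

text \<open>
  By equality of dimensions it is enough that the map is injective on \<open>U\<^sub>i\<close>.  A vector of the
  kernel has no component \<open>E\<^sub>h\<close> with \<open>h \<ge> d - i\<close>, hence lies in
  \<open>F\<^sub>i\<^sub>+\<^sub>1 \<inter> (E\<^sub>0V + \<dots> + E\<^sub>d\<^sub>-\<^sub>i\<^sub>-\<^sub>1V) = 0\<close>.
\<close>

lemma T_U_onto:
  assumes "2 * i \<le> d"
  shows "P.T i (d - i) ` U i = U (d - i)"
proof (rule subspace_dim_equal)
  show "subspace (P.T i (d - i) ` U i)"
    by (intro lm.linear_subspace_image P.linear_poly_map subspace_U)
  show "subspace (U (d - i))"
    by (rule subspace_U)
  show "P.T i (d - i) ` U i \<subseteq> U (d - i)"
    using T_U assms by auto
  have "v = 0" if "v \<in> U i" "P.T i (d - i) v = 0" for v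
    using that P.T_eq_0[OF that(2)] lower_Int_lower_cross[of "Suc i"] assms
    by (auto simp: U_def)
  then have "inj_on (P.T i (d - i)) (U i)"
    using lm.linear_inj_on_iff_eq_0[OF P.linear_poly_map subspace_U] by blast
  then have "dim (P.T i (d - i) ` U i) = dim (U i)"
    by (intro lm.dim_image_eq P.linear_poly_map) (simp add: span_eq_iff[THEN iffD2] subspace_U)
  then show "dim (U (d - i)) \<le> dim (P.T i (d - i) ` U i)"
    using dim_U_reflect[of i] assms by simp
qed

text \<open>For \<open>2i \<le> d\<close>, \<open>K i\<close> is the kernel of \<open>\<tau>\<^sub>i\<^sub>,\<^sub>d\<^sub>-\<^sub>i\<^sub>+\<^sub>1(A)\<close> on \<open>U i\<close>.\<close>

definition K :: "nat \<Rightarrow> 'v set" where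
  "K i = U i \<inter> lower d E (Suc (d - i))"

definition S :: "nat \<Rightarrow> 'v set" where
  "S i = span (\<Union>j\<in>{j. j \<le> i \<and> i + j \<le> d}. P.T j i ` K j)"

lemma T_S:
  assumes "i \<le> k" "i + k \<le> d" "v \<in> S i"
  shows "P.T i k v \<in> S k"
proof -
  let ?X = "\<Union>j\<in>{j. j \<le> i \<and> i + j \<le> d}. P.T j i ` K j"
  have "P.T i k ` S i = span (P.T i k ` ?X)"
    unfolding S_def by (rule lm.linear_span_image[OF P.linear_poly_map, symmetric])
  also have "\<dots> \<subseteq> S k"
    unfolding S_def
  proof (rule span_mono, rule subsetI)
    fix w
    assume "w \<in> P.T i k ` ?X"
    then obtain j u where ju: "j \<le> i" "i + j \<le> d" "u \<in> K j" "w = P.T i k (P.T j i u)"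
      by blast
    then have "w = P.T j k u"
      using assms(1) by (simp add: P.T_T)
    moreover have "j \<le> k" "k + j \<le> d"
      using ju assms(1,2) by auto
    ultimately show "w \<in> (\<Union>j\<in>{j. j \<le> k \<and> k + j \<le> d}. P.T j k ` K j)"
      using ju(3) by blast
  qed
  finally show ?thesis
    using assms(3) by blast
qed

lemma K_S: "2 * i \<le> d \<Longrightarrow> K i \<subseteq> S i"
proof
  fix v
  assume "2 * i \<le> d" "v \<in> K i"
  then have "i \<in> {j. j \<le> i \<and> i + j \<le> d}" "v \<in> P.T i i ` K i"
    by (auto simp: P.T_refl)
  then show "v \<in> S i"
    unfolding S_def by (intro span_base UN_I)
qed

text \<open>
  Given \<open>v \<in> U\<^sub>i\<^sub>+\<^sub>1\<close>, surjectivity onto \<open>U\<^sub>d\<^sub>-\<^sub>i\<close> provides \<open>u \<in> U\<^sub>i\<close> such that \<open>(A - \<theta>\<^sub>i)u\<close> and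
  \<open>v\<close> have the same image under \<open>\<tau>\<^sub>i\<^sub>+\<^sub>1\<^sub>,\<^sub>d\<^sub>-\<^sub>i(A)\<close>.  Their difference is in \<open>K\<^sub>i\<^sub>+\<^sub>1\<close>, and \<open>u\<close> is
  covered by induction.
\<close>

lemma U_subset_S_left: "2 * i \<le> d \<Longrightarrow> U i \<subseteq> S i"
proof (induction i)
  case 0
  have "U 0 \<subseteq> K 0"
    by (auto simp: K_def lower_def)
  then show ?case
    using K_S[of 0] by simp
next
  case (Suc i)
  show ?case
  proof
    fix v
    assume v: "v \<in> U (Suc i)"
    have "P.T (Suc i) (d - i) v \<in> U (d - i)"
      using T_U[OF v, of "d - i"] Suc.prems by simp
    then have "P.T (Suc i) (d - i) v \<in> P.T i (d - i) ` U i"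
      using T_U_onto[of i] Suc.prems by simp
    then obtain u where u: "P.T (Suc i) (d - i) v = P.T i (d - i) u" "u \<in> U i"
      by (rule imageE)
    define w where "w = v - P.T i (Suc i) u"
    have "w \<in> U (Suc i)"
      unfolding w_def using T_U[OF u(2), of "Suc i"] v by (intro subspace_diff subspace_U) auto
    moreover have "P.T (Suc i) (d - i) w = 0"
      using u(1) Suc.prems by (simp add: w_def lm.linear_diff P.linear_poly_map P.T_T)
    then have "w \<in> lower d E (d - i)"
      by (rule P.T_eq_0)
    ultimately have "w \<in> K (Suc i)"
      using Suc.prems by (simp add: K_def Suc_diff_Suc)
    then have "w \<in> S (Suc i)"
      using K_S[OF Suc.prems] by blast
    moreover have "P.T i (Suc i) u \<in> S (Suc i)"
      using Suc u(2) by (intro T_S) auto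
    ultimately have "w + P.T i (Suc i) u \<in> S (Suc i)"
      unfolding S_def by (rule span_add)
    then show "v \<in> S (Suc i)"
      by (simp add: w_def)
  qed
qed

text \<open>Beyond the middle, \<open>U\<^sub>i\<close> is the image of \<open>U\<^sub>d\<^sub>-\<^sub>i\<close>.\<close>

lemma U_subset_S:
  assumes "i \<le> d"
  shows "U i \<subseteq> S i"
proof (cases "2 * i \<le> d")
  case True
  then show ?thesis
    by (rule U_subset_S_left)
next
  case False
  then have le: "2 * (d - i) \<le> d" "d - i \<le> i" "d - i + i \<le> d"
    using assms by auto
  have "U i = P.T (d - i) i ` U (d - i)"
    using T_U_onto[OF le(1)] assms by (simp only: diff_diff_cancel)
  also have "\<dots> \<subseteq> S i"
    using U_subset_S_left[OF le(1)] T_S[OF le(2,3)] by (intro image_subsetI) blast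
  finally show ?thesis .
qed

section \<open>Maps lowering the split decomposition\<close>

text \<open>
  On \<open>S\<^sub>j\<close> the hypothesis on \<open>\<Psi>\<close> removes one factor of \<open>\<tau>\<^sub>l\<^sub>j(A)\<close>, and \<open>\<tau>\<^sub>l\<^sub>,\<^sub>j\<^sub>-\<^sub>1(A)K\<^sub>l\<close> is
  reached from \<open>F\<^sub>l\<^sub>+\<^sub>1\<close> in \<open>j - 1 - l\<close> steps, so \<open>\<Psi>S\<^sub>j \<subseteq> F\<^sub>j\<close>.  The flag is then climbed by
  \<open>F\<^sub>j\<^sub>+\<^sub>1 = F\<^sub>j + U\<^sub>j\<close> with \<open>U\<^sub>j \<subseteq> S\<^sub>j\<close>.
\<close>

lemma lowering_map_lowers:
  assumes lin: "Vector_Spaces.linear scale scale \<Psi>"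
    and \<Psi>: "\<And>i j v. v \<in> K i \<Longrightarrow> i \<le> j \<Longrightarrow> i + j \<le> d \<Longrightarrow>
      \<exists>c. \<Psi> (P.T i j v) = scale c (if j = i then 0 else P.T i (j - 1) v)"
    and "i \<le> d"
  shows "\<Psi> ` lower d Es (Suc i) \<subseteq> lower d Es i"
proof -
  have S: "\<Psi> ` S j \<subseteq> lower d Es j" for j
  proof -
    have "\<Psi> (P.T l j v) \<in> lower d Es j" if l: "l \<le> j" "j + l \<le> d" and v: "v \<in> K l" for l v
    proof -
      have "P.T l (j - 1) v \<in> lower d Es j" if "j \<noteq> l"
        using T_lower[of v "Suc l" l "j - 1"] l v that by (auto simp: K_def U_def)
      moreover obtain c where "\<Psi> (P.T l j v) = scale c (if j = l then 0 else P.T l (j - 1) v)"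
        using \<Psi>[OF v] l by (auto simp: add.commute)
      ultimately show ?thesis
        by (auto intro: subspace_scale subspace_0 Ps.subspace_lower)
    qed
    then have "span (\<Psi> ` (\<Union>l\<in>{l. l \<le> j \<and> j + l \<le> d}. P.T l j ` K l)) \<subseteq> lower d Es j"
      by (intro span_minimal Ps.subspace_lower) auto
    then show ?thesis
      unfolding S_def by (simp add: lm.linear_span_image lin)
  qed
  have step: "\<Psi> v \<in> lower d Es j"
    if j: "j \<le> d" "v \<in> lower d Es (Suc j)" "\<Psi> ` lower d Es j \<subseteq> lower d Es j" for j v
  proof -
    obtain x y where xy: "x \<in> lower d Es j" "y \<in> U j" "v = x + y"
      using j(2) unfolding lower_Suc[OF j(1)] by blast
    have "\<Psi> x \<in> lower d Es j" "\<Psi> y \<in> lower d Es j"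
      using xy(1,2) j(3) U_subset_S[OF j(1)] S[of j] by blast+
    then show ?thesis
      using xy lin by (auto simp: lm.linear_add intro: subspace_add Ps.subspace_lower)
  qed
  show ?thesis
    using \<open>i \<le> d\<close>
  proof (induction i)
    case 0
    have "\<Psi> ` lower d Es 0 \<subseteq> lower d Es 0"
      using lin by (simp add: Ps.lower_0 lm.linear_0)
    then show ?case
      using step[of 0] by blast
  next
    case (Suc i)
    then have "\<Psi> ` lower d Es (Suc i) \<subseteq> lower d Es (Suc i)"
      using lower_mono[of i "Suc i" d Es] by auto
    then show ?case
      using step[of "Suc i"] Suc.prems by blast
  qed
qed

end

section \<open>The projections of a tridiagonal system\<close>

lemma eigen_resolutionI:
  assumes "vector_space scale" "Vector_Spaces.linear scale scale A" "diagonalizable scale A"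
    and E: "bij_betw E {0..d} (primitive_idempotents scale A)"
    and V: "bij_betw (\<lambda>i. range (E i)) {0..d} (eigenspaces scale A)"
  shows "eigen_resolution scale d A E (eigenvalue_seq scale A E)"
proof -
  interpret vector_space scale by fact
  interpret lm: vector_space_pair scale scale ..
  let ?\<theta> = "eigenvalue_seq scale A E"
  have idem: "primitive_idempotent scale A (range (E h)) (E h)" if "h \<le> d" for h
  proof -
    have "E h \<in> primitive_idempotents scale A"
      using bij_betwE[OF E] that by simp
    then show ?thesis
      by (auto simp: primitive_idempotents_def primitive_idempotent_def)
  qed
  then have lin: "Vector_Spaces.linear scale scale (E h)" if "h \<le> d" for h
    using that by (auto simp: primitive_idempotent_def)
  have range_E: "range (E h) \<in> eigenspaces scale A" if "h \<le> d" for h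
    using bij_betwE[OF V] that by simp
  have range_eqD: "h = k" if "range (E h) = range (E k)" "h \<le> d" "k \<le> d" for h k
    using inj_onD[OF bij_betw_imp_inj_on[OF V] that(1)] that(2,3) by simp
  have EE: "E h (E k v) = (if h = k then E k v else 0)" if "h \<le> d" "k \<le> d" for h k v
  proof (cases "h = k")
    case True
    then show ?thesis
      using idem[OF that(1)] by (auto simp: primitive_idempotent_def)
  next
    case False
    then have "range (E k) \<noteq> range (E h)"
      using range_eqD[of k h] that by auto
    then show ?thesis
      using idem[OF that(1)] range_E[OF that(2)] False by (auto simp: primitive_idempotent_def)
  qed
  have eig: "range (E h) = eigenspace scale A (?\<theta> h) \<and> range (E h) \<noteq> {0}" if h: "h \<le> d" for h
  proof -
    obtain t where t: "range (E h) = eigenspace scale A t" "range (E h) \<noteq> {0}"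
      using range_E[OF h] by (auto simp: eigenspaces_def)
    have "\<exists>v\<in>range (E h). v \<noteq> 0"
      using t(2) by fastforce
    then obtain v where v: "v \<in> range (E h)" "v \<noteq> 0"
      by blast
    have "?\<theta> h = t"
      unfolding eigenvalue_seq_def
    proof (rule the_equality)
      show "\<forall>v\<in>range (E h). A v = scale t v"
        using t by (auto simp: eigenspace_def)
      fix s
      assume "\<forall>v\<in>range (E h). A v = scale s v"
      then have "scale s v = scale t v"
        using v t by (auto simp: eigenspace_def)
      then show "s = t"
        using v(2) by simp
    qed
    then show ?thesis
      using t by simp
  qed
  show ?thesis
  proof (intro eigen_resolution.intro eigen_resolution_axioms.intro vector_space_axioms)
    show "Vector_Spaces.linear scale scale A"
      by fact
    show "Vector_Spaces.linear scale scale (E h)" if "h \<le> d" for h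
      using lin that .
    show "E h (E k v) = (if h = k then E k v else 0)" if "h \<le> d" "k \<le> d" for h k v
      using EE that .
    show "(\<Sum>h\<le>d. E h v) = v" for v
    proof -
      have "v \<in> span (\<Union> (eigenspaces scale A))"
        using assms(3) by (simp add: diagonalizable_def)
      then show ?thesis
      proof (induction rule: span_induct_alt)
        case base
        then show ?case
          using lin by (simp add: lm.linear_0)
      next
        case (step c x y)
        have "x \<in> (\<Union>k\<in>{0..d}. range (E k))"
          using step(1) bij_betw_imp_surj_on[OF V] by simp
        then obtain k u where k: "k \<le> d" and x: "x = E k u"
          by auto
        have "(\<Sum>h\<le>d. E h x) = (\<Sum>h\<le>d. if h = k then E k u else 0)"
          using k by (intro sum.cong) (auto simp: x EE)
        then have "(\<Sum>h\<le>d. E h x) = x"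
          using k by (simp add: x)
        moreover have "(\<Sum>h\<le>d. E h (scale c x + y)) = scale c (\<Sum>h\<le>d. E h x) + (\<Sum>h\<le>d. E h y)"
          using lin by (simp add: lm.linear_add lm.linear_scale scale_sum_right sum.distrib)
        ultimately show ?case
          using step by simp
      qed
    qed
    show "A (E h v) = scale (?\<theta> h) (E h v)" if "h \<le> d" for h v
      using eig[OF that] by (auto simp: eigenspace_def)
    show "inj_on ?\<theta> {..d}"
    proof (rule inj_onI)
      fix h k
      assume "h \<in> {..d}" "k \<in> {..d}" "?\<theta> h = ?\<theta> k"
      then have "range (E h) = range (E k)"
        using eig by auto
      then show "h = k"
        using range_eqD \<open>h \<in> {..d}\<close> \<open>k \<in> {..d}\<close> by simp
    qed
    show "\<exists>v. E h v \<noteq> 0" if "h \<le> d" for h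
      using eig[OF that] by auto
  qed
qed

text \<open>
  Block tridiagonality of \<open>B\<close> on eigenspaces becomes the vanishing of \<open>E\<^sub>h B E\<^sub>k\<close> for
  \<open>\<bar>h - k\<bar> > 1\<close>.
\<close>

lemma tridiagonal_projections:
  assumes "eigen_resolution scale d A E \<theta>"
    and "standard_ordering scale A B d (\<lambda>i. range (E i))"
    and "h \<le> d" "k \<le> d" "Suc h < k \<or> Suc k < h"
  shows "E h (B (E k v)) = 0"
proof -
  interpret eigen_resolution scale d A E \<theta> by fact
  have "B ` range (E k) \<subseteq> (if k = 0 then {0} else range (E (k - 1))) + range (E k)
      + (if k = d then {0} else range (E (k + 1)))"
    using assms(2,4) by (simp add: standard_ordering_def)
  then have "B (E k v) \<in> (if k = 0 then {0} else range (E (k - 1))) + range (E k)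
      + (if k = d then {0} else range (E (k + 1)))"
    by blast
  then obtain a b c where "B (E k v) = a + b + c"
    "a \<in> (if k = 0 then {0} else range (E (k - 1)))" "b \<in> range (E k)"
    "c \<in> (if k = d then {0} else range (E (k + 1)))"
    by (auto elim!: set_plus_elim)
  moreover from this have "E h a = 0" "E h b = 0" "E h c = 0"
    using assms(3-5) by (auto simp: E_E E_zero split: if_splits)
  ultimately show ?thesis
    using assms(3) by (simp add: E_add)
qed

lemma td_systemI:
  assumes "finite_dimensional_vector_space scale Basis"
    and td: "tridiagonal_system scale d A E As Es"
  shows "td_system scale Basis d A E (eigenvalue_seq scale A E) As Es (eigenvalue_seq scale As Es)"
proof -
  interpret finite_dimensional_vector_space scale Basis by fact
  have P: "eigen_resolution scale d A E (eigenvalue_seq scale A E)"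
    using td by (intro eigen_resolutionI vector_space_axioms)
      (auto simp: tridiagonal_system_def tridiagonal_pair_def standard_ordering_def)
  have Ps: "eigen_resolution scale d As Es (eigenvalue_seq scale As Es)"
    using td by (intro eigen_resolutionI vector_space_axioms)
      (auto simp: tridiagonal_system_def tridiagonal_pair_def standard_ordering_def)
  have "E h (As (E k v)) = 0" if "h \<le> d" "k \<le> d" "Suc h < k \<or> Suc k < h" for h k v
    using td that by (intro tridiagonal_projections[OF P]) (auto simp: tridiagonal_system_def)
  moreover have "Es h (A (Es k v)) = 0" if "h \<le> d" "k \<le> d" "Suc h < k \<or> Suc k < h" for h k v
    using td that by (intro tridiagonal_projections[OF Ps]) (auto simp: tridiagonal_system_def)
  moreover have "W = {0} \<or> W = UNIV" if "subspace W" "A ` W \<subseteq> W" "As ` W \<subseteq> W" for W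
    using td that by (auto simp: tridiagonal_system_def tridiagonal_pair_def)
  ultimately show ?thesis
    using P Ps by (simp add: td_system_def td_system_axioms_def finite_dimensional_vector_space_axioms)
qed

theorem lemma16p1:
  fixes scale :: "'k::field \<Rightarrow> 'v::ab_group_add \<Rightarrow> 'v"
    and Basis :: "'v set"
    and d :: nat
    and A As \<Psi> :: "'v \<Rightarrow> 'v"
    and E Es :: "nat \<Rightarrow> 'v \<Rightarrow> 'v"
  assumes "finite_dimensional_vector_space scale Basis"
    and "vector_space.dim scale (UNIV :: 'v set) > 0"
    and "d \<ge> 1"
    and "tridiagonal_system scale d A E As Es"
    and "is_Psi scale d A E Es \<Psi>"
  shows "\<forall>i\<le>d. \<Psi> ` range (Es i) \<subseteq> (\<Sum>h<i. range (Es h))"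
proof (intro allI impI)
  fix i
  assume i: "i \<le> d"
  interpret td_system scale Basis d A E "eigenvalue_seq scale A E" As Es "eigenvalue_seq scale As Es"
    using assms(1,4) by (rule td_systemI)
  have K: "K j \<subseteq> K_space d E Es j" if "j \<le> d" for j
  proof -
    have "K j \<subseteq> lower d Es (Suc j) \<inter> upper d Es 0"
      by (auto simp: K_def U_def upper_def)
    also have "\<dots> \<subseteq> (\<Sum>h=0..j. range (Es h))"
      using Ps.lower_subset_sum_range[of "Suc j" 0] that by (simp add: atLeastLessThanSuc_atLeastAtMost)
    finally have "K j \<subseteq> (\<Sum>h=0..j. range (Es h))" .
    moreover have "K j \<subseteq> (\<Sum>h=j..d - j. range (E h))"
      using P.lower_subset_sum_range[of "Suc (d - j)" j]
      by (auto simp: K_def U_def atLeastLessThanSuc_atLeastAtMost)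
    ultimately show ?thesis
      by (simp add: K_space_def)
  qed
  have "\<Psi> ` lower d Es (Suc i) \<subseteq> lower d Es i"
  proof (rule lowering_map_lowers[OF _ _ i])
    show "Vector_Spaces.linear scale scale \<Psi>"
      using assms(5) by (simp add: is_Psi_def Let_def)
    fix l j v
    assume "v \<in> K l" "l \<le> j" "l + j \<le> d"
    moreover from this have "v \<in> K_space d E Es l"
      using K[of l] by auto
    ultimately show "\<exists>c. \<Psi> (P.T l j v) = scale c (if j = l then 0 else P.T l (j - 1) v)"
      using assms(5) unfolding is_Psi_def Let_def by fastforce
  qed
  moreover have "range (Es i) \<subseteq> lower d Es (Suc i)"
    using i by (auto simp: lower_def Ps.E_E)
  moreover have "lower d Es i \<subseteq> (\<Sum>h<i. range (Es h))"
    using Ps.lower_subset_sum_range[of i 0] i by (simp add: upper_def lessThan_atLeast0)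
  ultimately show "\<Psi> ` range (Es i) \<subseteq> (\<Sum>h<i. range (Es h))"
    by blast
qed

end
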